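(* Let $D$ be a finite simple digraph in which every vertex has out-degree at least $1$. Then $g(D)\le 2\phi(D)$, where $\phi(D)=\sum_{v\in V(D)}\frac{1}{\deg^+(v)+1}$.
   Context: $\deg^+(v)$ is the out-degree of $v$. The girth $g(D)$ is the length of a shortest directed cycle of $D$ ($\infty$ if none). A simple digraph has no loops and no parallel edges (oppositely oriented edges between two vertices are allowed). *)

theory Defs
  imports "Graph_Theory.Arc_Walk" "HOL-Library.Extended_Real"
begin

(* The infimum is over enat, so the girth of an acyclic digraph is \<infinity>.
   A pair of oppositely oriented arcs is a cycle of length 2. *)
definition girth :: "('a, 'b) pre_digraph \<Rightarrow> enat" where
  "girth D = (INF c \<in> {c. pre_digraph.cycle D c}. enat (length c))"

definition phi :: "('a, 'b) pre_digraph \<Rightarrow> real" where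
  "phi D = (\<Sum>v \<in> verts D. 1 / (real (out_degree D v) + 1))"

end

theory Submission
  imports Defs
begin

text \<open>
  Let \<open>d v\<close> be the out-degree of \<open>v\<close>, put \<open>x v = 1 / (d v + 1)\<close> and let
  \<open>S w = (\<Sum>y \<rightarrow> w. x y / d y)\<close>. Since \<open>x y / d y = 1 / d y - x y\<close>, deleting \<open>w\<close> changes \<open>\<phi>\<close> by
  \<open>S w - x w\<close>, and counting arcs by their tails gives \<open>(\<Sum>w. S w) = (\<Sum>w. x w)\<close>.
  In a smallest counterexample, however, \<open>S w > x w\<close> for every \<open>w\<close>. If no in-neighbour of \<open>w\<close> has
  out-degree 1, this holds because deleting \<open>w\<close> creates no sink and no cycle. If \<open>z \<rightarrow> w\<close> is the only
  arc leaving \<open>z\<close>, contract it: this decreases the girth by at most 1, and decreases \<open>\<phi>\<close> by \<open>1 / 2\<close>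
  unless some \<open>y\<close> has arcs to both \<open>z\<close> and \<open>w\<close>; but then \<open>z\<close> and \<open>y\<close> together give
  \<open>S w > 1 / 2 \<ge> x w\<close>.
\<close>

section \<open>Walks as powers of a relation\<close>

lemma relpow_subset:
  fixes R S :: "('a \<times> 'a) set"
  assumes "R \<subseteq> S"
  shows "R ^^ k \<subseteq> S ^^ k"
  using assms by (induction k) (auto intro!: relcomp_mono)

text \<open>This undoes a contraction of \<open>z\<close> into \<open>w\<close>. If a walk uses
  redirected steps, keep its part up to the first one, now ending in \<open>z\<close>, and its part
  after the last one, starting in \<open>w\<close>; dropping what lies between only shortens
  it.\<close>

lemma relpow_shortcut:
  assumes step: "\<And>u v. (u, v) \<in> R' \<Longrightarrow> (u, v) \<in> R \<or> (u, z) \<in> R \<and> v = w"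
    and "(a, b) \<in> R' ^^ k"
  shows "(a, b) \<in> R ^^ k \<or> (\<exists>i j. (a, z) \<in> R ^^ i \<and> (w, b) \<in> R ^^ j \<and> i + j \<le> k)"
  using assms(2)
proof (induction k arbitrary: b)
  case 0
  then show ?case by simp
next
  case (Suc k)
  then obtain c where c: "(a, c) \<in> R' ^^ k" "(c, b) \<in> R'" by auto
  note IH = Suc.IH[OF c(1)]
  from step[OF c(2)] show ?case
  proof
    assume "(c, b) \<in> R"
    from IH show ?thesis
    proof
      assume "(a, c) \<in> R ^^ k"
      with \<open>(c, b) \<in> R\<close> show ?thesis by auto
    next
      assume "\<exists>i j. (a, z) \<in> R ^^ i \<and> (w, c) \<in> R ^^ j \<and> i + j \<le> k"
      then obtain i j where "(a, z) \<in> R ^^ i" "(w, c) \<in> R ^^ j" "i + j \<le> k" by blast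
      moreover from this have "(w, b) \<in> R ^^ Suc j" using \<open>(c, b) \<in> R\<close> by auto
      ultimately show ?thesis by (metis add_Suc_right Suc_le_mono)
    qed
  next
    assume cz: "(c, z) \<in> R \<and> b = w"
    from IH show ?thesis
    proof
      assume "(a, c) \<in> R ^^ k"
      with cz have "(a, z) \<in> R ^^ Suc k" "(w, b) \<in> R ^^ 0" by auto
      then show ?thesis by (metis add.right_neutral order_refl)
    next
      assume "\<exists>i j. (a, z) \<in> R ^^ i \<and> (w, c) \<in> R ^^ j \<and> i + j \<le> k"
      then obtain i j where "(a, z) \<in> R ^^ i" "i + j \<le> k" by blast
      moreover have "(w, b) \<in> R ^^ 0" using cz by simp
      ultimately show ?thesis by (metis add.right_neutral add_leD1 le_SucI)
    qed
  qed
qed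

lemma sum_in_neighbours:
  fixes f :: "'a \<Rightarrow> real"
  assumes "finite V" and "\<And>v. v \<in> V \<Longrightarrow> N v \<subseteq> V"
  shows "(\<Sum>w\<in>V. \<Sum>y\<in>{y\<in>V. w \<in> N y}. f y) = (\<Sum>y\<in>V. card (N y) * f y)"
proof -
  have "(\<Sum>w\<in>V. \<Sum>y\<in>{y\<in>V. w \<in> N y}. f y) = (\<Sum>y\<in>V. \<Sum>w\<in>{w\<in>V. w \<in> N y}. f y)"
    using assms(1) by (intro sum.swap_restrict) auto
  also have "\<dots> = (\<Sum>y\<in>V. card (N y) * f y)"
  proof (rule sum.cong)
    fix y assume "y \<in> V"
    then have "{w\<in>V. w \<in> N y} = N y" using assms(2) by blast
    then show "(\<Sum>w\<in>{w\<in>V. w \<in> N y}. f y) = card (N y) * f y" by simp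
  qed simp
  finally show ?thesis .
qed

text \<open>Each term is at least \<open>1 / (card V + 1)\<close>. The bound makes a loop, a closed
  walk of length 1, short enough.\<close>

lemma half_le_sum_inverse_Suc_card:
  assumes "finite V" "V \<noteq> {}" and "\<And>v. v \<in> V \<Longrightarrow> N v \<subseteq> V"
  shows "1 / 2 \<le> (\<Sum>v\<in>V. 1 / (real (card (N v)) + 1))"
proof -
  have pos: "card V \<ge> 1" using assms(1,2) by (simp add: Suc_leI card_gt_0_iff)
  then have "1 / 2 \<le> card V * (1 / (real (card V) + 1))" by (simp add: field_simps)
  also have "\<dots> = (\<Sum>v\<in>V. 1 / (real (card V) + 1))" by simp
  also have "\<dots> \<le> (\<Sum>v\<in>V. 1 / (real (card (N v)) + 1))"
    using assms by (intro sum_mono divide_left_mono) (auto intro!: card_mono)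
  finally show ?thesis .
qed

text \<open>Loops are allowed because contracting \<open>z\<close> into \<open>w\<close> creates one
  when \<open>w\<close> has an arc to \<open>z\<close>. Closed walks replace cycles because they
  need not stay simple when a contraction is undone.\<close>

lemma ex_short_closed_walk:
  fixes N :: "'a \<Rightarrow> 'a set"
  assumes "finite V" "V \<noteq> {}"
    and "\<And>v. v \<in> V \<Longrightarrow> N v \<noteq> {}" and "\<And>v. v \<in> V \<Longrightarrow> N v \<subseteq> V"
  shows "\<exists>k>0. (\<exists>v. (v, v) \<in> Sigma V N ^^ k) \<and>
    real k \<le> 2 * (\<Sum>v\<in>V. 1 / (real (card (N v)) + 1))"
  using assms
proof (induction "card V" arbitrary: V N rule: less_induct)
  case less
  note fin = less.prems(1) and sub = less.prems(4)
  define d where "d v = real (card (N v))" for v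
  define x where "x v = 1 / (d v + 1)" for v
  define S where "S w = (\<Sum>y\<in>{y\<in>V. w \<in> N y}. x y / d y)" for w
  have finN: "finite (N v)" if "v \<in> V" for v
    using that sub fin finite_subset by blast
  have d1: "d v \<ge> 1" if "v \<in> V" for v
    using that finN less.prems(3) unfolding d_def by (simp add: Suc_leI card_gt_0_iff)
  have xd: "x v / d v > 0" if "v \<in> V" for v
    using d1[OF that] by (simp add: x_def)
  show ?case
  proof (rule ccontr)
    assume "\<not> ?thesis"
    then have long: "real k > 2 * (\<Sum>v\<in>V. x v)" if "(v, v) \<in> Sigma V N ^^ k" "k > 0" for k v
      using that unfolding x_def d_def by (meson not_le)
    have noloop: "v \<notin> N v" if "v \<in> V" for v
    proof
      assume "v \<in> N v"
      then have "(v, v) \<in> Sigma V N ^^ 1" using that by simp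
      then have "1 > 2 * (\<Sum>v\<in>V. x v)" using long by fastforce
      then show False
        using half_le_sum_inverse_Suc_card[of V N, OF fin less.prems(2) sub] by (simp add: x_def d_def)
    qed
    have "x w < S w" if w: "w \<in> V" for w
    proof (cases "\<exists>z\<in>V. w \<in> N z \<and> card (N z) = 1")
      case False
      define W where "W = V - {w}"
      define M where "M v = N v - {w}" for v
      have WV: "Sigma W M \<subseteq> Sigma V N" by (auto simp: W_def M_def)
      obtain u where "u \<in> N w" using less.prems(3)[OF w] by blast
      then have neW: "W \<noteq> {}" using noloop[OF w] sub[OF w] by (auto simp: W_def)
      have neM: "M v \<noteq> {}" if "v \<in> W" for v
        using that False less.prems(3)[of v] by (auto simp: W_def M_def subset_singleton_iff)
      have subM: "M v \<subseteq> W" if "v \<in> W" for v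
        using that sub by (auto simp: W_def M_def)
      have less_card: "card W < card V" using w fin unfolding W_def by (meson card_Diff1_less)
      have finW: "finite W" using fin by (simp add: W_def)
      have "\<exists>k>0. (\<exists>v. (v, v) \<in> Sigma W M ^^ k) \<and>
          real k \<le> 2 * (\<Sum>v\<in>W. 1 / (real (card (M v)) + 1))"
        using less_card finW neW neM subM by (rule less.hyps)
      then obtain k v where k: "k > 0" "(v, v) \<in> Sigma W M ^^ k"
          "real k \<le> 2 * (\<Sum>v\<in>W. 1 / (real (card (M v)) + 1))"
        by (elim exE conjE)
      \<comment> \<open>The closed walk also lives in \<open>V\<close>, so it is long there;
        comparing this with the bound from the induction leaves \<open>x w < S w\<close>.\<close>
      have "2 * (\<Sum>v\<in>V. x v) < real k"
        by (rule long[OF subsetD[OF relpow_subset[OF WV] k(2)] k(1)])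
      also note k(3)
      also have "(\<Sum>v\<in>W. 1 / (real (card (M v)) + 1)) =
          (\<Sum>v\<in>W. x v + (if w \<in> N v then x v / d v else 0))"
      proof (rule sum.cong)
        fix v assume "v \<in> W"
        then have v: "v \<in> V" by (simp add: W_def)
        show "1 / (real (card (M v)) + 1) = x v + (if w \<in> N v then x v / d v else 0)"
        proof (cases "w \<in> N v")
          case True
          then have "real (card (M v)) = d v - 1"
            using finN[OF v] d1[OF v] by (simp add: M_def d_def of_nat_diff)
          moreover have "d v \<noteq> 0" "d v + 1 \<noteq> 0" using d1[OF v] by auto
          ultimately show ?thesis using True by (simp add: x_def divide_simps)
        qed (simp add: M_def x_def d_def)
      qed simp
      also have "\<dots> = (\<Sum>v\<in>W. x v) + (\<Sum>v\<in>W. if w \<in> N v then x v / d v else 0)"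
        by (rule sum.distrib)
      also have "(\<Sum>v\<in>W. if w \<in> N v then x v / d v else 0) = S w"
      proof -
        \<comment> \<open>Without a loop at \<open>w\<close>, all its in-neighbours survive the
          deletion.\<close>
        have "{v \<in> W. w \<in> N v} = {y\<in>V. w \<in> N y}" using noloop[OF w] by (auto simp: W_def)
        then show ?thesis using fin unfolding S_def
          by (simp add: sum.inter_filter[symmetric] W_def)
      qed
      also have "(\<Sum>v\<in>W. x v) = (\<Sum>v\<in>V. x v) - x w"
        using fin w by (simp add: W_def sum_diff1)
      finally show ?thesis by simp
    next
      case True
      then obtain z where z: "z \<in> V" "w \<in> N z" "card (N z) = 1" by blast
      then have Nz: "N z = {w}" by (metis card_1_singletonE singletonD)
      have zw: "z \<noteq> w" using noloop z by blast
      have "\<exists>y\<in>V. z \<in> N y \<and> w \<in> N y"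
      proof (rule ccontr)
        assume no: "\<not> (\<exists>y\<in>V. z \<in> N y \<and> w \<in> N y)"
        define W where "W = V - {z}"
        \<comment> \<open>Contraction: \<open>z\<close> is deleted and arcs into \<open>z\<close>
          are redirected to \<open>w\<close>. By \<open>no\<close>, redirecting never merges two
          arcs, so out-degrees are kept.\<close>
        define M where "M v = (if z \<in> N v then insert w (N v - {z}) else N v)" for v
        have cardM: "card (M v) = card (N v)" if "v \<in> V" for v
          using that no finN[OF that] less.prems(3)[OF that]
          by (auto simp: M_def card_gt_0_iff)
        have neW: "W \<noteq> {}" using w zw by (auto simp: W_def)
        have neM: "M v \<noteq> {}" if "v \<in> W" for v
          using that less.prems(3)[of v] by (auto simp: W_def M_def)
        have subM: "M v \<subseteq> W" if "v \<in> W" for v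
          using that sub[of v] w zw by (auto simp: W_def M_def)
        have less_card: "card W < card V" using z fin unfolding W_def by (meson card_Diff1_less)
        have finW: "finite W" using fin by (simp add: W_def)
        have "\<exists>k>0. (\<exists>v. (v, v) \<in> Sigma W M ^^ k) \<and>
            real k \<le> 2 * (\<Sum>v\<in>W. 1 / (real (card (M v)) + 1))"
          using less_card finW neW neM subM by (rule less.hyps)
        then obtain k v where k: "k > 0" "(v, v) \<in> Sigma W M ^^ k"
            "real k \<le> 2 * (\<Sum>v\<in>W. 1 / (real (card (M v)) + 1))"
          by (elim exE conjE)
        have "(\<Sum>v\<in>W. 1 / (real (card (M v)) + 1)) = (\<Sum>v\<in>W. x v)"
          using cardM by (intro sum.cong) (auto simp: x_def d_def W_def)
        also have "\<dots> = (\<Sum>v\<in>V. x v) - 1 / 2"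
          using fin z by (simp add: W_def sum_diff1 x_def d_def)
        \<comment> \<open>The lost term \<open>x z = 1 / 2\<close> counts twice, which pays for one
          additional arc.\<close>
        finally have k3: "real k + 1 \<le> 2 * (\<Sum>v\<in>V. x v)" using k(3) by simp
        have "(v, v) \<in> Sigma V N ^^ k \<or>
            (\<exists>i j. (v, z) \<in> Sigma V N ^^ i \<and> (w, v) \<in> Sigma V N ^^ j \<and> i + j \<le> k)"
          using k(2) by (rule relpow_shortcut[rotated]) (auto simp: W_def M_def split: if_splits)
        then show False
        proof
          assume "(v, v) \<in> Sigma V N ^^ k"
          then show False using long k(1) k3 by fastforce
        next
          assume "\<exists>i j. (v, z) \<in> Sigma V N ^^ i \<and> (w, v) \<in> Sigma V N ^^ j \<and> i + j \<le> k"
          then obtain i j where ij: "(v, z) \<in> Sigma V N ^^ i" "(w, v) \<in> Sigma V N ^^ j" "i + j \<le> k"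
            by blast
          then have "(w, z) \<in> Sigma V N ^^ (j + i)" by (auto simp: relpow_add)
          \<comment> \<open>The arc from \<open>z\<close> to \<open>w\<close> closes the walk; this
            is the one additional arc, and it makes the length positive.\<close>
          then have "(w, w) \<in> Sigma V N ^^ Suc (j + i)" using z by auto
          then have "2 * (\<Sum>v\<in>V. x v) < real (Suc (j + i))" by (rule long) simp
          then show False using k3 ij(3) by linarith
        qed
      qed
      then obtain y where y: "y \<in> V" "z \<in> N y" "w \<in> N y" by blast
      have "y \<noteq> z" using y Nz zw by auto
      have "x w \<le> 1 / 2" using d1[OF w] by (simp add: x_def field_simps)
      \<comment> \<open>Since \<open>d z = 1\<close>, the term of \<open>z\<close> in
        \<open>S w\<close> is already \<open>1 / 2\<close>; the positive term of \<open>y\<close>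
        makes the inequality strict.\<close>
      also have "1 / 2 = x z / d z" using z(3) by (simp add: x_def d_def)
      also have "\<dots> < x z / d z + x y / d y" using xd[OF y(1)] by simp
      also have "\<dots> = (\<Sum>v\<in>{z, y}. x v / d v)" using \<open>y \<noteq> z\<close> by simp
      also have "\<dots> \<le> S w" unfolding S_def
        using y z fin xd by (intro sum_mono2) (auto intro: less_imp_le)
      finally show ?thesis .
    qed
    then have "(\<Sum>w\<in>V. x w) < (\<Sum>w\<in>V. S w)"
      using fin less.prems(2) by (intro sum_strict_mono) auto
    also have "\<dots> = (\<Sum>y\<in>V. d y * (x y / d y))"
      unfolding S_def d_def using fin sub by (rule sum_in_neighbours)
    also have "\<dots> = (\<Sum>y\<in>V. x y)"
      using d1 by (intro sum.cong) force+
    finally show False by simp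
  qed
qed

section \<open>From relation powers to cycles of a digraph\<close>

lemma (in wf_digraph) relpow_imp_awalk:
  assumes "(u, v) \<in> (SIGMA u:verts G. head G ` out_arcs G u) ^^ k" and "u \<in> verts G"
  shows "\<exists>p. awalk u p v \<and> length p = k"
  using assms
proof (induction k arbitrary: v)
  case 0
  then show ?case by (auto simp: awalk_Nil_iff intro: exI[of _ "[]"])
next
  case (Suc k)
  then obtain c where "(u, c) \<in> (SIGMA u:verts G. head G ` out_arcs G u) ^^ k"
    and c: "v \<in> head G ` out_arcs G c" by auto
  with Suc obtain p where p: "awalk u p c" "length p = k" by blast
  from c obtain e where "e \<in> arcs G" "tail G e = c" "head G e = v" by auto
  then have "awalk c [e] v" by (auto simp: awalk_simps)
  with p have "awalk u (p @ [e]) v" "length (p @ [e]) = Suc k"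
    by (auto intro: awalk_appendI)
  then show ?case by blast
qed

text \<open>If a vertex repeats after the first arc is removed, the remaining walk contains a closed
  walk, which is strictly shorter than \<open>p\<close>, and induction applies.\<close>

lemma (in wf_digraph) closed_w_imp_short_cycle:
  assumes "closed_w p"
  shows "\<exists>c. cycle c \<and> length c \<le> length p"
  using assms
proof (induction "length p" arbitrary: p rule: less_induct)
  case less
  then obtain u where u: "awalk u p u" "p \<noteq> []" by (auto simp: closed_w_def)
  show ?case
  proof (cases "distinct (tl (awalk_verts u p))")
    case True
    with u show ?thesis by (auto simp: cycle_def)
  next
    case False
    obtain e es where p: "p = e # es" using u(2) by (cases p) auto
    with False u have "awalk (head G e) es u" "\<not> distinct (awalk_verts (head G e) es)"
      by (auto simp: awalk_Cons_iff)
    then obtain q r s where "es = q @ r @ s" "closed_w r"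
      by (rule awalk_cyc_decompE')
    with p have "length r < length p" "closed_w r" by auto
    with less.hyps show ?thesis by (meson le_trans less_imp_le)
  qed
qed

theorem theorem4p1:
  fixes D :: "('a, 'b) pre_digraph"
  assumes "digraph D"
    and "verts D \<noteq> {}"
    and "\<And>v. v \<in> verts D \<Longrightarrow> out_degree D v \<ge> 1"
  shows "ereal_of_enat (girth D) \<le> ereal (2 * phi D)"
proof -
  interpret digraph D by fact
  define N where "N v = head D ` out_arcs D v" for v
  \<comment> \<open>Without parallel arcs, \<open>head D\<close> is injective on the arcs leaving
    \<open>v\<close>.\<close>
  have card: "card (N v) = out_degree D v" for v
    unfolding N_def out_degree_def
    by (rule card_image) (auto intro!: inj_onI no_multi_arcs simp: arc_to_ends_def)
  have ne: "N v \<noteq> {}" if "v \<in> verts D" for v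
    using assms(3)[OF that] card[of v] by auto
  have sub: "N v \<subseteq> verts D" for v by (auto simp: N_def)
  obtain k v where k: "k > 0" "(v, v) \<in> Sigma (verts D) N ^^ k"
      "real k \<le> 2 * (\<Sum>v\<in>verts D. 1 / (real (card (N v)) + 1))"
    using ex_short_closed_walk[of "verts D" N, OF finite_verts assms(2) ne sub] by blast
  \<comment> \<open>Here \<open>k > 0\<close> matters: the zeroth power relates every
    \<open>v\<close> to itself, even outside the digraph.\<close>
  have "v \<in> verts D"
    using k(1,2) by (metis SigmaD1 gr0_implies_Suc relpow_Suc_D2)
  then obtain p where "awalk v p v" "length p = k"
    using relpow_imp_awalk k(2) unfolding N_def by blast
  with k(1) have "closed_w p" by (auto simp: closed_w_def)
  then obtain c where c: "cycle c" "length c \<le> k"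
    using closed_w_imp_short_cycle \<open>length p = k\<close> by blast
  have "girth D \<le> enat (length c)"
    unfolding girth_def using c(1) by (intro INF_lower) simp
  also have "\<dots> \<le> enat k" using c(2) by simp
  finally have "ereal_of_enat (girth D) \<le> ereal_of_enat (enat k)"
    by (simp only: ereal_of_enat_le_iff)
  also have "\<dots> \<le> ereal (2 * phi D)"
    using k(3) by (simp add: phi_def card)
  finally show ?thesis .
qed

end
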